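(* Let $\Bbbk$ be a field. For all integers $m\ge1$ and $1\le q\le m$, let $X=\mathcal K_1\ast(m\mathcal K_2)$ be the friendship graph and let $R$ be the polynomial ring over $\Bbbk$ in the $2m+1$ variables given by the vertices of $X$. Then the Krull dimension satisfies \[ \dim\big(R/I(X)^{[q]}\big)=m+q-1 . \]
   Context: The friendship graph $\mathcal K_1\ast(m\mathcal K_2)$ consists of $m$ pairwise vertex-disjoint edges together with one further vertex $v$ adjacent to all $2m$ of their endpoints (equivalently, $m$ triangles sharing the vertex $v$). A $q$-matching of a graph is a set $M$ of $q$ pairwise vertex-disjoint edges, and $V(M)$ is the set of vertices it covers. For a graph $X$, the $q$-th squarefree power $I(X)^{[q]}$ is the ideal, in the polynomial ring over $\Bbbk$ whose variables are the vertices of $X$, generated by all monomials $\prod_{u\in V(M)}u$ with $M$ a $q$-matching of $X$. *)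

theory Defs
  imports "HOL-Algebra.QuotRing" "HOL-Library.Poly_Mapping" "HOL-Library.Extended_Nat"
    "HOL-Library.Disjoint_Sets"
begin

section \<open>Krull dimension\<close>

text \<open>The supremum of the lengths of strict chains of prime ideals, a chain
  \<open>P 0 \<subset> \<dots> \<subset> P n\<close> having length \<open>n\<close>.  The supremum is taken in \<open>enat\<close>, so the
  zero ring, which has no prime ideals, gets the value \<open>0\<close> instead of \<open>-\<infinity>\<close>.\<close>

definition prime_chain :: "('a, 'b) ring_scheme \<Rightarrow> nat \<Rightarrow> (nat \<Rightarrow> 'a set) \<Rightarrow> bool" where
  "prime_chain R n P \<longleftrightarrow> (\<forall>i\<le>n. primeideal (P i) R) \<and> (\<forall>i<n. P i \<subset> P (Suc i))"

definition krull_dim :: "('a, 'b) ring_scheme \<Rightarrow> enat" where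
  "krull_dim R = Sup {enat n | n. \<exists>P. prime_chain R n P}"


section \<open>Polynomial rings\<close>

text \<open>A monomial is its exponent vector \<open>'v \<Rightarrow>\<^sub>0 nat\<close> and a polynomial maps monomials to their
  coefficients.  The type allows every element of \<open>'v\<close> as a variable; the carrier below
  consists of the polynomials that involve only variables from \<open>V\<close>.\<close>

type_synonym ('v, 'k) mpoly = "('v \<Rightarrow>\<^sub>0 nat) \<Rightarrow>\<^sub>0 'k"

definition mpoly_ring :: "'v set \<Rightarrow> ('v, 'k::field) mpoly ring" where
  "mpoly_ring V =
    \<lparr>carrier = {p. \<forall>t\<in>Poly_Mapping.keys p. Poly_Mapping.keys t \<subseteq> V},
     mult = (*), one = 1, zero = 0, add = (+)\<rparr>"

definition variable :: "'v \<Rightarrow> ('v, 'k::field) mpoly" where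
  "variable u = Poly_Mapping.single (Poly_Mapping.single u 1) 1"


section \<open>Graphs, matchings and squarefree powers\<close>

text \<open>An edge is a two-element set of vertices.\<close>

record 'v graph =
  verts :: "'v set"
  edges :: "'v set set"

definition simple_graph :: "'v graph \<Rightarrow> bool" where
  "simple_graph X \<longleftrightarrow> finite (verts X) \<and> (\<forall>e\<in>edges X. e \<subseteq> verts X \<and> card e = 2)"

definition matching :: "'v graph \<Rightarrow> nat \<Rightarrow> 'v set set \<Rightarrow> bool" where
  "matching X q M \<longleftrightarrow> M \<subseteq> edges X \<and> finite M \<and> card M = q \<and> disjoint M"

definition squarefree_power :: "'v graph \<Rightarrow> nat \<Rightarrow> ('v, 'k::field) mpoly set" where
  "squarefree_power X q =
    genideal (mpoly_ring (verts X)) {\<Prod>u\<in>\<Union>M. variable u | M. matching X q M}"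

text \<open>The vertex \<open>0\<close> is the common vertex of the triangles, and the \<open>m\<close> disjoint edges are
  \<open>{2 * i + 1, 2 * i + 2}\<close> for \<open>i < m\<close>.\<close>

definition friendship_graph :: "nat \<Rightarrow> nat graph" where
  "friendship_graph m =
    \<lparr>verts = {0..2 * m},
     edges = {{2 * i + 1, 2 * i + 2} | i. i < m} \<union> {{0, u} | u. u \<in> {1..2 * m}}\<rparr>"


section \<open>Well-formedness\<close>

lemma simple_graph_friendship_graph: "simple_graph (friendship_graph m)"
  by (auto simp: simple_graph_def friendship_graph_def)

lemma card_verts_friendship_graph: "card (verts (friendship_graph m)) = 2 * m + 1"
  by (simp add: friendship_graph_def)

lemma keys_subset_mpoly_mult:
  fixes p q :: "('v, 'k::field) mpoly"
  assumes "\<forall>t\<in>Poly_Mapping.keys p. Poly_Mapping.keys t \<subseteq> V"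
    and "\<forall>t\<in>Poly_Mapping.keys q. Poly_Mapping.keys t \<subseteq> V"
  shows "\<forall>t\<in>Poly_Mapping.keys (p * q). Poly_Mapping.keys t \<subseteq> V"
proof
  fix t assume "t \<in> Poly_Mapping.keys (p * q)"
  then obtain a b where "a \<in> Poly_Mapping.keys p" "b \<in> Poly_Mapping.keys q" "t = a + b"
    using keys_mult[of p q] by blast
  then show "Poly_Mapping.keys t \<subseteq> V"
    using assms keys_add[of a b] by blast
qed

lemma mpoly_ring_cring: "cring (mpoly_ring V :: ('v, 'k::field) mpoly ring)"
proof (rule cringI)
  show "abelian_group (mpoly_ring V :: ('v, 'k) mpoly ring)"
  proof (rule abelian_groupI)
    fix p q :: "('v, 'k) mpoly"
    assume "p \<in> carrier (mpoly_ring V)" "q \<in> carrier (mpoly_ring V)"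
    then show "p \<oplus>\<^bsub>mpoly_ring V\<^esub> q \<in> carrier (mpoly_ring V)"
      using keys_add[of p q] by (auto simp: mpoly_ring_def)
  next
    fix p :: "('v, 'k) mpoly"
    assume "p \<in> carrier (mpoly_ring V)"
    then have "- p \<in> carrier (mpoly_ring V)"
      by (simp add: mpoly_ring_def)
    then show "\<exists>r\<in>carrier (mpoly_ring V). r \<oplus>\<^bsub>mpoly_ring V\<^esub> p = \<zero>\<^bsub>mpoly_ring V\<^esub>"
      by (rule bexI[rotated]) (simp add: mpoly_ring_def)
  qed (auto simp: mpoly_ring_def add_ac)
  show "Group.comm_monoid (mpoly_ring V :: ('v, 'k) mpoly ring)"
  proof (rule comm_monoidI)
    fix p q :: "('v, 'k) mpoly"
    assume "p \<in> carrier (mpoly_ring V)" "q \<in> carrier (mpoly_ring V)"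
    then show "p \<otimes>\<^bsub>mpoly_ring V\<^esub> q \<in> carrier (mpoly_ring V)"
      using keys_subset_mpoly_mult[of p V q] by (auto simp: mpoly_ring_def)
  qed (auto simp: mpoly_ring_def mult_ac)
qed (auto simp: mpoly_ring_def distrib_right)

lemma variable_in_mpoly_ring:
  "u \<in> V \<Longrightarrow> (variable u :: ('v, 'k::field) mpoly) \<in> carrier (mpoly_ring V)"
  by (simp add: mpoly_ring_def variable_def)

lemma prod_variable_in_mpoly_ring:
  assumes "U \<subseteq> V"
  shows "(\<Prod>u\<in>U. variable u :: ('v, 'k::field) mpoly) \<in> carrier (mpoly_ring V)"
  using assms
proof (induction U rule: infinite_finite_induct)
  case (insert u U)
  then show ?case
    using variable_in_mpoly_ring[of u V, where 'k = 'k]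
      keys_subset_mpoly_mult[of "variable u" V "\<Prod>u\<in>U. variable u :: ('v, 'k) mpoly"]
    by (auto simp: mpoly_ring_def)
qed (simp_all add: mpoly_ring_def)

lemma ideal_squarefree_power:
  assumes "simple_graph X"
  shows "ideal (squarefree_power X q :: ('v, 'k::field) mpoly set) (mpoly_ring (verts X))"
proof -
  interpret cring "mpoly_ring (verts X) :: ('v, 'k) mpoly ring"
    by (rule mpoly_ring_cring)
  have "\<Union>M \<subseteq> verts X" if "matching X q M" for M
    using assms that by (auto simp: simple_graph_def matching_def)
  then have "{\<Prod>u\<in>\<Union>M. variable u :: ('v, 'k) mpoly | M. matching X q M}
      \<subseteq> carrier (mpoly_ring (verts X))"
    using prod_variable_in_mpoly_ring by blast
  then show ?thesis
    unfolding squarefree_power_def by (rule genideal_ideal)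
qed

end

theory Submission
  imports Defs
begin

text \<open>A prime ideal containing a squarefree monomial contains one of its variables, so the
  variables outside a prime over the \<open>q\<close>-th squarefree power form a set \<open>W\<close> of vertices whose
  induced subgraph has no \<open>q\<close>-matching.  Conversely, for every such \<open>W\<close> the variables outside \<open>W\<close> generate a prime over
  the ideal, with quotient \<open>k[W]\<close>.  The dimension is therefore the largest size of such a \<open>W\<close>
  (\<open>krull_dim_squarefree_monomial_quotient\<close>).

  The lower bound comes from the chain of primes generated by more and more variables
  (\<open>card_le_krull_dim_quotient\<close>).  The upper bound (\<open>prime_chain_length_le\<close>) amounts to
  \<open>dim k[W] \<le> |W|\<close> and is obtained without integral extensions or transcendence degrees.  From a
  chain \<open>P 0 \<subset> \<dots> \<subset> P n\<close> choose \<open>x i \<in> P (i + 1) - P i\<close>; modulo \<open>P 0\<close> these can be taken in \<open>k[W]\<close>.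
  If \<open>n > |W|\<close>, there are more monomials with bounded exponents in \<open>x 0, \<dots>, x (n - 1)\<close> than the dimension
  of the space of polynomials in which they lie, so a nontrivial polynomial relation holds between
  the \<open>x i\<close> (\<open>algebraically_dependent\<close>).  But following the lexicographically lowest term of the
  relation along the chain, one factor \<open>x i\<close> after the other can be cancelled, until a nonzero
  constant is left in \<open>P n\<close> (\<open>relation_not_in_prime_chain\<close>).

  For the friendship graph, one endpoint of each of the \<open>m\<close> disjoint edges and the second endpoint
  of \<open>q - 1\<close> of them form a set of size \<open>m + q - 1\<close> whose induced subgraph has only \<open>q - 1\<close> edges.
  A larger set contains both endpoints of \<open>q\<close> of the edges, or of \<open>q - 1\<close> of them together with
  the common vertex and an endpoint of one more; in either case its induced subgraph has a
  \<open>q\<close>-matching.\<close>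

section \<open>Prime chains in a quotient ring\<close>

lemma (in cring) coset_mem_image_iff:
  assumes "ideal I R" "ideal P R" "I \<subseteq> P" "a \<in> carrier R"
  shows "I +> a \<in> (+>) I ` P \<longleftrightarrow> a \<in> P"
proof -
  have "ideal ((+>) I ` P) (R Quot I)"
    using ring_ideal_imp_quot_ideal[OF assms(1,2)] .
  then have "(+>) I ` P \<subseteq> carrier (R Quot I)"
    using additive_subgroup.a_subset[OF ideal.axioms(1)] by blast
  moreover have "P = \<Union> ((+>) I ` P)"
    using ideal_incl_iff[OF assms(1,2)] assms(3) by simp
  ultimately show ?thesis
    using canonical_proj_vimage_mem_iff[OF assms(1) _ assms(4)] by metis
qed

lemma (in cring) primeideal_image_quotient:
  assumes I: "ideal I R" and P: "primeideal P R" and "I \<subseteq> P"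
  shows "primeideal ((+>) I ` P) (R Quot I)"
proof (rule primeidealI)
  interpret P: primeideal P R by fact
  interpret I: ideal I R by fact
  have mem: "I +> a \<in> (+>) I ` P \<longleftrightarrow> a \<in> P" if "a \<in> carrier R" for a
    using coset_mem_image_iff[OF I P.is_ideal assms(3) that] .
  show "ideal ((+>) I ` P) (R Quot I)"
    using ring_ideal_imp_quot_ideal[OF I P.is_ideal] .
  show "cring (R Quot I)"
    using I.quotient_is_cring is_cring .
  have "\<one> \<notin> P"
    using P.I_notcarr P.one_imp_carrier by blast
  then have "I +> \<one> \<notin> (+>) I ` P"
    using mem by blast
  moreover have "I +> \<one> \<in> carrier (R Quot I)"
    using I.rcos_ring_hom one_closed by (rule ring_hom_closed)
  ultimately show "carrier (R Quot I) \<noteq> (+>) I ` P"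
    by blast
  fix A B
  assume "A \<in> carrier (R Quot I)" "B \<in> carrier (R Quot I)"
    and AB: "A \<otimes>\<^bsub>R Quot I\<^esub> B \<in> (+>) I ` P"
  then obtain a b where ab: "a \<in> carrier R" "A = I +> a" "b \<in> carrier R" "B = I +> b"
    unfolding FactRing_def using A_RCOSETS_def'[of R I] by auto
  have "A \<otimes>\<^bsub>R Quot I\<^esub> B = I +> (a \<otimes> b)"
    using ab I.rcoset_mult_add by (simp add: FactRing_def)
  then have "a \<otimes> b \<in> P"
    using AB mem ab by auto
  then show "A \<in> (+>) I ` P \<or> B \<in> (+>) I ` P"
    using P.I_prime ab by blast
qed

text \<open>Primes of \<open>R/I\<close> correspond to primes of \<open>R\<close> over \<open>I\<close> by preimage and image, and both maps
  preserve strict inclusions.  Every prime of a chain contains \<open>I\<close> as soon as the first does.\<close>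

lemma (in cring) krull_dim_quotient:
  assumes I: "ideal I R"
  shows "krull_dim (R Quot I) = Sup {enat n | n. \<exists>P. prime_chain R n P \<and> I \<subseteq> P 0}"
proof -
  interpret I: ideal I R by fact
  have "(\<exists>Q. prime_chain (R Quot I) n Q) \<longleftrightarrow> (\<exists>P. prime_chain R n P \<and> I \<subseteq> P 0)" for n
  proof
    assume "\<exists>Q. prime_chain (R Quot I) n Q"
    then obtain Q where Q: "\<And>i. i \<le> n \<Longrightarrow> primeideal (Q i) (R Quot I)"
      "\<And>i. i < n \<Longrightarrow> Q i \<subset> Q (Suc i)"
      by (auto simp: prime_chain_def)
    define P where "P i = {r \<in> carrier R. I +> r \<in> Q i}" for i
    have "primeideal (P i) R" if "i \<le> n" for i
      unfolding P_def
      using ring_hom_ring.primeideal_vimage[OF I.rcos_ring_hom_ring is_cring Q(1)[OF that]] .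
    moreover have "P i \<subset> P (Suc i)" if i: "i < n" for i
    proof -
      obtain X where X: "X \<in> Q (Suc i)" "X \<notin> Q i"
        using Q(2)[OF i] by blast
      have "ideal (Q (Suc i)) (R Quot I)"
        using Q(1)[of "Suc i"] i by (simp add: primeideal_def)
      then have "X \<in> carrier (R Quot I)"
        using X additive_subgroup.a_subset[OF ideal.axioms(1)] by blast
      then obtain r where "r \<in> carrier R" "X = I +> r"
        unfolding FactRing_def using A_RCOSETS_def'[of R I] by auto
      then show ?thesis
        using X Q(2)[OF i] by (auto simp: P_def)
    qed
    moreover have "I \<subseteq> P 0"
    proof
      fix a assume a: "a \<in> I"
      have "ideal (Q 0) (R Quot I)"
        using Q(1)[of 0] by (simp add: primeideal_def)
      then have "\<zero>\<^bsub>R Quot I\<^esub> \<in> Q 0"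
        using additive_subgroup.zero_closed[OF ideal.axioms(1)] by blast
      then show "a \<in> P 0"
        using a a_rcos_zero[OF I a] I.a_Hcarr by (simp add: P_def FactRing_def)
    qed
    ultimately show "\<exists>P. prime_chain R n P \<and> I \<subseteq> P 0"
      by (auto simp: prime_chain_def)
  next
    assume "\<exists>P. prime_chain R n P \<and> I \<subseteq> P 0"
    then obtain P where P: "\<And>i. i \<le> n \<Longrightarrow> primeideal (P i) R"
      "\<And>i. i < n \<Longrightarrow> P i \<subset> P (Suc i)" "I \<subseteq> P 0"
      by (auto simp: prime_chain_def)
    have sub: "I \<subseteq> P i" if "i \<le> n" for i
      using that
    proof (induction i)
      case (Suc i)
      then show ?case using P(2)[of i] by auto
    qed (use P(3) in simp)
    have "(+>) I ` P i \<subset> (+>) I ` P (Suc i)" if i: "i < n" for i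
    proof -
      obtain r where r: "r \<in> P (Suc i)" "r \<notin> P i"
        using P(2)[OF i] by blast
      have id: "ideal (P i) R" "ideal (P (Suc i)) R"
        using P(1)[of i] P(1)[of "Suc i"] i by (auto simp: primeideal_def)
      then have "r \<in> carrier R"
        using r additive_subgroup.a_subset[OF ideal.axioms(1)] by blast
      then have "I +> r \<notin> (+>) I ` P i"
        using coset_mem_image_iff[OF I id(1) sub] r i by simp
      then show ?thesis
        using r P(2)[OF i] by blast
    qed
    then have "prime_chain (R Quot I) n (\<lambda>i. (+>) I ` P i)"
      using primeideal_image_quotient[OF I P(1) sub] by (simp add: prime_chain_def)
    then show "\<exists>Q. prime_chain (R Quot I) n Q" by blast
  qed
  then show ?thesis
    by (simp add: krull_dim_def)
qed


section \<open>Polynomials and their coordinate primes\<close>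

lemma mpoly_ring_simps [simp]:
  "mult (mpoly_ring V) = (*)" "one (mpoly_ring V) = 1" "zero (mpoly_ring V) = 0"
  "add (mpoly_ring V) = (+)"
  by (simp_all add: mpoly_ring_def)

lemma mem_mpoly_ring_iff:
  "p \<in> carrier (mpoly_ring V) \<longleftrightarrow> (\<forall>t\<in>Poly_Mapping.keys p. Poly_Mapping.keys t \<subseteq> V)"
  by (simp add: mpoly_ring_def)

lemma a_inv_mpoly_ring:
  fixes p :: "('v, 'k::field) mpoly"
  assumes "p \<in> carrier (mpoly_ring V)"
  shows "a_inv (mpoly_ring V) p = - p"
proof -
  interpret cring "mpoly_ring V :: ('v, 'k) mpoly ring" by (rule mpoly_ring_cring)
  have "- p \<in> carrier (mpoly_ring V)"
    using assms by (simp add: mem_mpoly_ring_iff)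
  then show ?thesis
    using assms minus_equality[of "- p" p] by simp
qed

lemma mpoly_carrier_closed:
  fixes p q :: "('v, 'k::field) mpoly"
  assumes "p \<in> carrier (mpoly_ring V)"
  shows "q \<in> carrier (mpoly_ring V) \<Longrightarrow> p + q \<in> carrier (mpoly_ring V)"
    and "q \<in> carrier (mpoly_ring V) \<Longrightarrow> p * q \<in> carrier (mpoly_ring V)"
    and "p ^ k \<in> carrier (mpoly_ring V)"
proof -
  interpret cring "mpoly_ring V :: ('v, 'k) mpoly ring" by (rule mpoly_ring_cring)
  show "q \<in> carrier (mpoly_ring V) \<Longrightarrow> p + q \<in> carrier (mpoly_ring V)"
    and mult: "q \<in> carrier (mpoly_ring V) \<Longrightarrow> p * q \<in> carrier (mpoly_ring V)" for q
    using a_closed[of p q] m_closed[of p q] assms by simp_all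
  show "p ^ k \<in> carrier (mpoly_ring V)"
    by (induction k) (use mult one_closed in simp_all)
qed

lemma mpoly_carrier_sum_prod:
  fixes f :: "'a \<Rightarrow> ('v, 'k::field) mpoly"
  assumes "\<And>a. a \<in> A \<Longrightarrow> f a \<in> carrier (mpoly_ring V)"
  shows "sum f A \<in> carrier (mpoly_ring V)" and "prod f A \<in> carrier (mpoly_ring V)"
proof -
  have zero_one: "(0 :: ('v, 'k) mpoly) \<in> carrier (mpoly_ring V)"
    "(1 :: ('v, 'k) mpoly) \<in> carrier (mpoly_ring V)"
    by (simp_all add: mem_mpoly_ring_iff)
  show "sum f A \<in> carrier (mpoly_ring V)"
    using assms by (induction A rule: infinite_finite_induct)
      (simp_all add: zero_one mpoly_carrier_closed(1))
  show "prod f A \<in> carrier (mpoly_ring V)"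
    using assms by (induction A rule: infinite_finite_induct)
      (simp_all add: zero_one mpoly_carrier_closed(2))
qed

lemma mpoly_ideal_closed:
  fixes I :: "('v, 'k::field) mpoly set"
  assumes "ideal I (mpoly_ring V)"
  shows "a \<in> I \<Longrightarrow> a \<in> carrier (mpoly_ring V)"
    and "0 \<in> I"
    and "a \<in> I \<Longrightarrow> b \<in> I \<Longrightarrow> a + b \<in> I"
    and "a \<in> I \<Longrightarrow> b \<in> I \<Longrightarrow> a - b \<in> I"
    and "a \<in> I \<Longrightarrow> x \<in> carrier (mpoly_ring V) \<Longrightarrow> x * a \<in> I"
proof -
  interpret ideal I "mpoly_ring V" by fact
  note sub = additive_subgroup_axioms
  show carr: "a \<in> I \<Longrightarrow> a \<in> carrier (mpoly_ring V)" for a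
    using a_Hcarr .
  show "0 \<in> I"
    using additive_subgroup.zero_closed[OF sub] by simp
  show add: "a \<in> I \<Longrightarrow> b \<in> I \<Longrightarrow> a + b \<in> I" for a b
    using additive_subgroup.a_closed[OF sub, of a b] by simp
  have neg: "a \<in> I \<Longrightarrow> - a \<in> I" for a
    using additive_subgroup.a_inv_closed[OF sub, of a] a_inv_mpoly_ring[OF carr, of a] by simp
  show "a \<in> I \<Longrightarrow> b \<in> I \<Longrightarrow> a - b \<in> I" for a b
    using add[OF _ neg, of a b] by simp
  show "a \<in> I \<Longrightarrow> x \<in> carrier (mpoly_ring V) \<Longrightarrow> x * a \<in> I" for a x
    using I_l_closed[of a x] by simp
qed

lemma mpoly_ideal_sum:
  fixes I :: "('v, 'k::field) mpoly set"
  assumes I: "ideal I (mpoly_ring V)" and "\<And>t. t \<in> T \<Longrightarrow> f t \<in> I"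
  shows "(\<Sum>t\<in>T. f t) \<in> I"
  using assms(2)
  by (induction T rule: infinite_finite_induct) (simp_all add: mpoly_ideal_closed(2,3)[OF I])

lemma mpoly_eq_sum_terms:
  fixes p :: "('v, 'k::field) mpoly"
  shows "p = (\<Sum>t\<in>Poly_Mapping.keys p. Poly_Mapping.single t (Poly_Mapping.lookup p t))"
  by (rule poly_mapping_eqI) (simp add: lookup_sum lookup_single when_def in_keys_iff)

definition restrict_vars :: "'v set \<Rightarrow> ('v, 'k::field) mpoly \<Rightarrow> ('v, 'k) mpoly" where
  "restrict_vars W p =
    (\<Sum>t\<in>{t\<in>Poly_Mapping.keys p. Poly_Mapping.keys t \<subseteq> W}.
      Poly_Mapping.single t (Poly_Mapping.lookup p t))"

lemma lookup_restrict_vars: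
  "Poly_Mapping.lookup (restrict_vars W p) t =
    (if Poly_Mapping.keys t \<subseteq> W then Poly_Mapping.lookup p t else 0)"
  by (auto simp: restrict_vars_def lookup_sum lookup_single when_def in_keys_iff)

lemma restrict_vars_mem: "restrict_vars W p \<in> carrier (mpoly_ring W)"
  unfolding mem_mpoly_ring_iff
  by (metis in_keys_iff lookup_restrict_vars)

lemma keys_diff_restrict_vars:
  "t \<in> Poly_Mapping.keys (p - restrict_vars W p) \<longleftrightarrow>
    t \<in> Poly_Mapping.keys p \<and> \<not> Poly_Mapping.keys t \<subseteq> W"
  by (auto simp: in_keys_iff lookup_minus lookup_restrict_vars)

text \<open>For \<open>W \<subseteq> V\<close> this is the ideal generated by the variables in \<open>V - W\<close>, that is, the kernel of
  the substitution \<open>k[V] \<rightarrow> k[W]\<close> of \<open>0\<close> for these variables.  In this form, membership is a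
  condition on each occurring monomial separately.\<close>

definition coordinate_ideal :: "'v set \<Rightarrow> 'v set \<Rightarrow> ('v, 'k::field) mpoly set" where
  "coordinate_ideal V W =
    {p \<in> carrier (mpoly_ring V). \<forall>t\<in>Poly_Mapping.keys p. \<not> Poly_Mapping.keys t \<subseteq> W}"

lemma keys_add_nat: "Poly_Mapping.keys (s + t :: 'v \<Rightarrow>\<^sub>0 nat) = Poly_Mapping.keys s \<union> Poly_Mapping.keys t"
  by (auto simp: in_keys_iff lookup_add)

lemma ideal_coordinate_ideal:
  "ideal (coordinate_ideal V W :: ('v, 'k::field) mpoly set) (mpoly_ring V)"
proof -
  interpret cring "mpoly_ring V :: ('v, 'k) mpoly ring" by (rule mpoly_ring_cring)
  have mult: "x * a \<in> coordinate_ideal V W"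
    if "a \<in> coordinate_ideal V W" "x \<in> carrier (mpoly_ring V)" for a x :: "('v, 'k) mpoly"
  proof -
    have "x * a \<in> carrier (mpoly_ring V)"
      using m_closed[of x a] that by (simp add: coordinate_ideal_def)
    moreover have "\<not> Poly_Mapping.keys t \<subseteq> W" if t: "t \<in> Poly_Mapping.keys (x * a)" for t
    proof -
      obtain r s where "s \<in> Poly_Mapping.keys a" "t = r + s"
        using t keys_mult[of x a] by blast
      then show ?thesis
        using \<open>a \<in> coordinate_ideal V W\<close> by (auto simp: coordinate_ideal_def keys_add_nat)
    qed
    ultimately show ?thesis by (simp add: coordinate_ideal_def)
  qed
  show ?thesis
  proof (rule idealI)
    show "subgroup (coordinate_ideal V W) (add_monoid (mpoly_ring V :: ('v, 'k) mpoly ring))"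
    proof (rule add.subgroupI)
      show "coordinate_ideal V W \<subseteq> carrier (mpoly_ring V :: ('v, 'k) mpoly ring)"
        by (auto simp: coordinate_ideal_def)
      have "(0 :: ('v, 'k) mpoly) \<in> coordinate_ideal V W"
        by (simp add: coordinate_ideal_def mem_mpoly_ring_iff)
      then show "coordinate_ideal V W \<noteq> ({} :: ('v, 'k) mpoly set)" by blast
      fix a b :: "('v, 'k) mpoly"
      assume a: "a \<in> coordinate_ideal V W"
      then show "a_inv (mpoly_ring V) a \<in> coordinate_ideal V W"
        by (simp add: a_inv_mpoly_ring coordinate_ideal_def mem_mpoly_ring_iff)
      assume b: "b \<in> coordinate_ideal V W"
      show "a \<oplus>\<^bsub>mpoly_ring V\<^esub> b \<in> coordinate_ideal V W"
        using a b keys_add[of a b] unfolding coordinate_ideal_def mem_mpoly_ring_iff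
        by simp blast
    qed
  next
    fix a x :: "('v, 'k) mpoly"
    assume "a \<in> coordinate_ideal V W" "x \<in> carrier (mpoly_ring V)"
    then show "x \<otimes>\<^bsub>mpoly_ring V\<^esub> a \<in> coordinate_ideal V W"
      and "a \<otimes>\<^bsub>mpoly_ring V\<^esub> x \<in> coordinate_ideal V W"
      using mult by (simp_all add: mult.commute)
  qed (rule ring_axioms)
qed

text \<open>Modulo the ideal every polynomial equals its restriction to \<open>W\<close>, and a nonzero polynomial
  in the variables \<open>W\<close> is not in the ideal; so primality reduces to the absence of zero divisors
  among polynomials.  The linear order on the variables induces an order on the monomials, from
  which the latter follows.\<close>

lemma primeideal_coordinate_ideal:
  "primeideal (coordinate_ideal V W :: ('v::linorder, 'k::field) mpoly set) (mpoly_ring V)"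
proof (rule primeidealI)
  let ?N = "coordinate_ideal V W :: ('v, 'k) mpoly set"
  show "ideal ?N (mpoly_ring V)" by (rule ideal_coordinate_ideal)
  note N = mpoly_ideal_closed[OF this]
  show "cring (mpoly_ring V :: ('v, 'k) mpoly ring)" by (rule mpoly_ring_cring)
  have "(1 :: ('v, 'k) mpoly) \<in> carrier (mpoly_ring V) - ?N"
    by (simp add: mem_mpoly_ring_iff coordinate_ideal_def)
  then show "carrier (mpoly_ring V) \<noteq> ?N" by blast
  fix a b :: "('v, 'k) mpoly"
  assume a: "a \<in> carrier (mpoly_ring V)" and b: "b \<in> carrier (mpoly_ring V)"
    and "a \<otimes>\<^bsub>mpoly_ring V\<^esub> b \<in> ?N"
  then have ab: "a * b \<in> ?N" by simp
  let ?a = "restrict_vars W a" and ?b = "restrict_vars W b"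
  have diff: "p - restrict_vars W p \<in> ?N" if "p \<in> carrier (mpoly_ring V)" for p
    using that by (auto simp: coordinate_ideal_def mem_mpoly_ring_iff keys_diff_restrict_vars)
  have car: "restrict_vars W p \<in> carrier (mpoly_ring V)"
    if "p \<in> carrier (mpoly_ring V)" for p :: "('v, 'k) mpoly"
    using that
    by (auto simp: mem_mpoly_ring_iff in_keys_iff lookup_restrict_vars split: if_splits)
  have in_N: "p \<in> ?N" if "p \<in> carrier (mpoly_ring V)" "restrict_vars W p = 0" for p
    using diff[OF that(1)] that(2) by simp
  have "(a - ?a) * b \<in> ?N" "?a * (b - ?b) \<in> ?N"
    using N(5)[OF diff[OF a] b] N(5)[OF diff[OF b] car[OF a]] by (simp_all add: mult.commute)
  then have "a * b - (a - ?a) * b - ?a * (b - ?b) \<in> ?N"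
    using ab N(4) by blast
  also have "a * b - (a - ?a) * b - ?a * (b - ?b) = ?a * ?b"
    by (simp add: algebra_simps)
  finally have "?a * ?b \<in> ?N" .
  moreover have "?a * ?b \<in> carrier (mpoly_ring W)"
    unfolding mem_mpoly_ring_iff
    using keys_subset_mpoly_mult restrict_vars_mem[of W a] restrict_vars_mem[of W b]
    by (metis mem_mpoly_ring_iff)
  ultimately have "Poly_Mapping.keys (?a * ?b) = {}"
    by (auto simp: coordinate_ideal_def mem_mpoly_ring_iff)
  then have "?a * ?b = 0" by simp
  then have "?a = 0 \<or> ?b = 0" by simp
  then show "a \<in> ?N \<or> b \<in> ?N"
    using in_N a b by blast
qed

lemma variable_mem_coordinate_ideal_iff:
  "(variable u :: ('v, 'k::field) mpoly) \<in> coordinate_ideal V W \<longleftrightarrow> u \<in> V - W"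
  by (auto simp: coordinate_ideal_def mem_mpoly_ring_iff variable_def)

lemma coordinate_ideal_antimono: "W' \<subseteq> W \<Longrightarrow> coordinate_ideal V W \<subseteq> coordinate_ideal V W'"
  by (auto simp: coordinate_ideal_def)

text \<open>Removing the elements of \<open>W\<close> one at a time gives a strict chain of coordinate primes, from
  the one of \<open>W\<close> to the one of \<open>{}\<close>.\<close>

lemma card_le_krull_dim_quotient:
  fixes I :: "('v::linorder, 'k::field) mpoly set"
  assumes I: "ideal I (mpoly_ring V)" and "I \<subseteq> coordinate_ideal V W"
    and "W \<subseteq> V" and "finite W"
  shows "enat (card W) \<le> krull_dim (mpoly_ring V Quot I)"
proof -
  interpret cring "mpoly_ring V :: ('v, 'k) mpoly ring" by (rule mpoly_ring_cring)
  obtain e where e: "bij_betw e {0..<card W} W"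
    using ex_bij_betw_nat_finite[OF \<open>finite W\<close>] by blast
  define P :: "nat \<Rightarrow> ('v, 'k) mpoly set"
    where "P i = coordinate_ideal V (e ` {i..<card W})" for i
  have "P i \<subset> P (Suc i)" if i: "i < card W" for i
  proof -
    have inj: "inj_on e {0..<card W}" and img: "e ` {0..<card W} = W"
      using e by (auto simp: bij_betw_def)
    have "e i \<notin> e ` {Suc i..<card W}"
      using i inj_onD[OF inj] by force
    moreover have "e i \<in> e ` {i..<card W}" "e i \<in> V"
      using i img \<open>W \<subseteq> V\<close> by auto
    ultimately have "variable (e i) \<in> P (Suc i)" "variable (e i) \<notin> P i"
      by (auto simp: P_def variable_mem_coordinate_ideal_iff)
    moreover have "P i \<subseteq> P (Suc i)"
      unfolding P_def by (rule coordinate_ideal_antimono) auto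
    ultimately show ?thesis by blast
  qed
  then have "prime_chain (mpoly_ring V) (card W) P"
    using primeideal_coordinate_ideal by (auto simp: prime_chain_def P_def)
  moreover have "I \<subseteq> P 0"
    using assms(2) e by (simp add: P_def bij_betw_def)
  ultimately show ?thesis
    unfolding krull_dim_quotient[OF I] by (intro Sup_upper) blast
qed

section \<open>Algebraic dependence\<close>

text \<open>Gaussian elimination: an equation with a nonzero coefficient eliminates one unknown.\<close>

lemma homogeneous_system_solution:
  fixes g :: "'a \<Rightarrow> 'b \<Rightarrow> 'k::field"
  assumes "finite B" "finite A" "card B < card A"
  shows "\<exists>f. (\<exists>a\<in>A. f a \<noteq> 0) \<and> (\<forall>b\<in>B. (\<Sum>a\<in>A. f a * g a b) = 0)"
  using assms
proof (induction B arbitrary: A g rule: finite_induct)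
  case empty
  then have "\<exists>a\<in>A. (1::'k) \<noteq> 0" by (auto simp: card_gt_0_iff)
  then show ?case by (intro exI[of _ "\<lambda>_. 1"]) auto
next
  case (insert b B)
  show ?case
  proof (cases "\<forall>a\<in>A. g a b = 0")
    case True
    obtain f where "\<exists>a\<in>A. f a \<noteq> 0" "\<forall>b\<in>B. (\<Sum>a\<in>A. f a * g a b) = 0"
      using insert.IH[of A g] insert.prems insert.hyps by auto
    then show ?thesis
      using True by (intro exI[of _ f]) auto
  next
    case False
    then obtain a0 where a0: "a0 \<in> A" "g a0 b \<noteq> 0" by blast
    define g' where "g' a c = g a c - g a b / g a0 b * g a0 c" for a c
    have "card B < card (A - {a0})"
      using insert a0 by simp
    then obtain f where f: "\<exists>a\<in>A - {a0}. f a \<noteq> 0"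
      "\<forall>c\<in>B. (\<Sum>a\<in>A - {a0}. f a * g' a c) = 0"
      using insert.IH[of "A - {a0}" g'] insert.prems by auto
    define s where "s = (\<Sum>a\<in>A - {a0}. f a * g a b / g a0 b)"
    define h where "h = f(a0 := - s)"
    have sum: "(\<Sum>a\<in>A. h a * g a c) = (\<Sum>a\<in>A - {a0}. f a * g' a c)" for c
    proof -
      have "(\<Sum>a\<in>A. h a * g a c) = - s * g a0 c + (\<Sum>a\<in>A - {a0}. h a * g a c)"
        using a0 insert.prems by (simp add: sum.remove h_def)
      also have "(\<Sum>a\<in>A - {a0}. h a * g a c) = (\<Sum>a\<in>A - {a0}. f a * g a c)"
        by (rule sum.cong) (auto simp: h_def)
      also have "- s * g a0 c + \<dots> = (\<Sum>a\<in>A - {a0}. f a * g' a c)"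
        by (simp add: s_def g'_def sum_distrib_left sum_subtractf algebra_simps)
      finally show ?thesis .
    qed
    have "(\<Sum>a\<in>A. h a * g a b) = 0"
      unfolding sum using a0 by (simp add: g'_def)
    moreover have "\<exists>a\<in>A. h a \<noteq> 0"
      using f(1) by (auto simp: h_def)
    ultimately show ?thesis
      using f(2) sum by (intro exI[of _ h]) auto
  qed
qed

definition bounded_monomials :: "'v set \<Rightarrow> nat \<Rightarrow> ('v \<Rightarrow>\<^sub>0 nat) set" where
  "bounded_monomials W D = {t. Poly_Mapping.keys t \<subseteq> W \<and> (\<forall>u. Poly_Mapping.lookup t u \<le> D)}"

lemma card_bounded_monomials_le:
  fixes W :: "'v set"
  assumes "finite W"
  shows "finite (bounded_monomials W D)" "card (bounded_monomials W D) \<le> (D + 1) ^ card W"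
proof -
  let ?f = "\<lambda>t :: 'v \<Rightarrow>\<^sub>0 nat. restrict (Poly_Mapping.lookup t) W"
  have inj: "inj_on ?f (bounded_monomials W D)"
  proof (rule inj_onI, rule poly_mapping_eqI)
    fix s t u
    assume st: "s \<in> bounded_monomials W D" "t \<in> bounded_monomials W D" "?f s = ?f t"
    show "Poly_Mapping.lookup s u = Poly_Mapping.lookup t u"
    proof (cases "u \<in> W")
      case True
      then show ?thesis using fun_cong[OF st(3), of u] by simp
    next
      case False
      then have "u \<notin> Poly_Mapping.keys s" "u \<notin> Poly_Mapping.keys t"
        using st by (auto simp: bounded_monomials_def)
      then show ?thesis by (simp add: in_keys_iff)
    qed
  qed
  have sub: "?f ` bounded_monomials W D \<subseteq> PiE W (\<lambda>_. {..D})"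
    by (auto simp: bounded_monomials_def)
  have fin: "finite (PiE W (\<lambda>_. {..D}))"
    using assms by (intro finite_PiE) auto
  show "finite (bounded_monomials W D)"
    using inj_on_finite[OF inj sub fin] .
  show "card (bounded_monomials W D) \<le> (D + 1) ^ card W"
    using card_inj_on_le[OF inj sub fin] assms by (simp add: card_PiE)
qed

lemma bounded_monomials_mult:
  fixes p q :: "('v, 'k::field) mpoly"
  assumes "Poly_Mapping.keys p \<subseteq> bounded_monomials W D" "Poly_Mapping.keys q \<subseteq> bounded_monomials W E"
  shows "Poly_Mapping.keys (p * q) \<subseteq> bounded_monomials W (D + E)"
proof
  fix t assume "t \<in> Poly_Mapping.keys (p * q)"
  then obtain r s where "r \<in> bounded_monomials W D" "s \<in> bounded_monomials W E" "t = r + s"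
    using keys_mult[of p q] assms by blast
  then show "t \<in> bounded_monomials W (D + E)"
    by (auto simp: bounded_monomials_def keys_add_nat lookup_add add_mono)
qed

lemma bounded_monomials_power:
  fixes p :: "('v, 'k::field) mpoly"
  assumes "Poly_Mapping.keys p \<subseteq> bounded_monomials W D"
  shows "Poly_Mapping.keys (p ^ k) \<subseteq> bounded_monomials W (k * D)"
proof (induction k)
  case 0
  show ?case by (simp add: bounded_monomials_def)
next
  case (Suc k)
  then show ?case
    using bounded_monomials_mult[OF assms Suc] by (simp add: add.commute)
qed

lemma bounded_monomials_prod_power:
  fixes y :: "nat \<Rightarrow> ('v, 'k::field) mpoly"
  assumes "\<And>i. i < n \<Longrightarrow> Poly_Mapping.keys (y i) \<subseteq> bounded_monomials W D"
  shows "Poly_Mapping.keys (\<Prod>i<n. y i ^ \<alpha> i) \<subseteq> bounded_monomials W ((\<Sum>i<n. \<alpha> i) * D)"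
  using assms
proof (induction n)
  case 0
  show ?case by (simp add: bounded_monomials_def)
next
  case (Suc n)
  then show ?case
    using bounded_monomials_mult[OF Suc.IH bounded_monomials_power[OF Suc.prems[of n]], of "\<alpha> n"]
    by (simp add: add_mult_distrib)
qed

lemma bounded_monomials_mono:
  "D \<le> E \<Longrightarrow> bounded_monomials W D \<subseteq> bounded_monomials W E"
  unfolding bounded_monomials_def using order_trans by blast

lemma common_exponent_bound:
  fixes y :: "nat \<Rightarrow> ('v, 'k::field) mpoly"
  assumes "\<And>i. i < n \<Longrightarrow> y i \<in> carrier (mpoly_ring W)"
  shows "\<exists>D. \<forall>i<n. Poly_Mapping.keys (y i) \<subseteq> bounded_monomials W D"
proof -
  define E where "E = (\<Union>i<n. \<Union>t\<in>Poly_Mapping.keys (y i).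
    Poly_Mapping.lookup t ` Poly_Mapping.keys t)"
  have fin: "finite E" unfolding E_def by auto
  define D where "D = Max (insert 0 E)"
  have "Poly_Mapping.lookup t u \<le> D" if "i < n" "t \<in> Poly_Mapping.keys (y i)" for i t u
  proof (cases "u \<in> Poly_Mapping.keys t")
    case True
    then have "Poly_Mapping.lookup t u \<in> insert 0 E"
      using that by (auto simp: E_def)
    then show ?thesis using fin unfolding D_def by (intro Max_ge) auto
  next
    case False
    then show ?thesis by (simp add: in_keys_iff)
  qed
  then have "Poly_Mapping.keys (y i) \<subseteq> bounded_monomials W D" if "i < n" for i
    using that assms[OF that] by (auto simp: bounded_monomials_def mem_mpoly_ring_iff)
  then show ?thesis by blast
qed

text \<open>More polynomials than variables satisfy a polynomial relation, with exponent vectors \<open>S\<close> and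
  coefficients \<open>c\<close>.  The \<open>(d + 1)^n\<close> products of the \<open>y i\<close> with exponents at most \<open>d\<close> involve at most
  \<open>(n d D + 1)^|W|\<close> monomials, where \<open>D\<close> bounds the exponents in the \<open>y i\<close>; as \<open>|W| < n\<close>, the first
  number is larger for large \<open>d\<close>, and linear algebra gives a linear relation between the products.
  Exponent vectors are extensional functions so that they are determined by their values below
  \<open>n\<close>.\<close>

lemma algebraically_dependent:
  fixes y :: "nat \<Rightarrow> ('v, 'k::field) mpoly"
  assumes W: "finite W" "card W < n" and y: "\<And>i. i < n \<Longrightarrow> y i \<in> carrier (mpoly_ring W)"
  obtains S c where "finite S" "S \<noteq> {}" "S \<subseteq> PiE {..<n} (\<lambda>_. UNIV)" "\<And>\<alpha>. \<alpha> \<in> S \<Longrightarrow> c \<alpha> \<noteq> 0"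
    "(\<Sum>\<alpha>\<in>S. Poly_Mapping.single 0 (c \<alpha>) * (\<Prod>i<n. y i ^ \<alpha> i)) = 0"
proof -
  obtain D where D: "\<And>i. i < n \<Longrightarrow> Poly_Mapping.keys (y i) \<subseteq> bounded_monomials W D"
    using common_exponent_bound[of n y W] y by auto
  \<comment> \<open>Since \<open>n d D + 1 \<le> (n D + 1) (d + 1)\<close>, it suffices that
    \<open>d + 1 > (n D + 1)^|W|\<close>.\<close>
  define d where "d = (n * D + 1) ^ card W"
  define A where "A = PiE {..<n} (\<lambda>_. {..d})"
  define B where "B = bounded_monomials W (n * d * D)"
  have keys: "Poly_Mapping.keys (\<Prod>i<n. y i ^ \<alpha> i) \<subseteq> B" if "\<alpha> \<in> A" for \<alpha>
  proof -
    have "(\<Sum>i<n. \<alpha> i) \<le> (\<Sum>i<n. d)"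
      using that by (intro sum_mono) (auto simp: A_def)
    then have "(\<Sum>i<n. \<alpha> i) * D \<le> n * d * D" by simp
    then have "bounded_monomials W ((\<Sum>i<n. \<alpha> i) * D) \<subseteq> B"
      unfolding B_def by (rule bounded_monomials_mono)
    with bounded_monomials_prod_power[of n y W D \<alpha>] D show ?thesis by (meson subset_trans)
  qed
  have "card B \<le> (n * d * D + 1) ^ card W"
    unfolding B_def by (rule card_bounded_monomials_le(2)[OF W(1)])
  also have "\<dots> \<le> ((n * D + 1) * (d + 1)) ^ card W"
    by (intro power_mono) (auto simp: algebra_simps)
  also have "\<dots> = d * (d + 1) ^ card W"
    by (simp only: power_mult_distrib d_def)
  also have "\<dots> < (d + 1) ^ Suc (card W)" by simp
  also have "\<dots> \<le> (d + 1) ^ n"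
    using W(2) by (intro power_increasing) auto
  also have "\<dots> = card A" by (simp add: A_def card_PiE)
  finally have "card B < card A" .
  moreover have "finite A" unfolding A_def by (intro finite_PiE) auto
  moreover have "finite B" unfolding B_def by (rule card_bounded_monomials_le(1)[OF W(1)])
  ultimately obtain f where f: "\<exists>\<alpha>\<in>A. f \<alpha> \<noteq> 0"
    "\<forall>t\<in>B. (\<Sum>\<alpha>\<in>A. f \<alpha> * Poly_Mapping.lookup (\<Prod>i<n. y i ^ \<alpha> i) t) = 0"
    using homogeneous_system_solution[of B A "\<lambda>\<alpha>. Poly_Mapping.lookup (\<Prod>i<n. y i ^ \<alpha> i)"]
    by auto
  define S where "S = {\<alpha>\<in>A. f \<alpha> \<noteq> 0}"
  have lookup: "Poly_Mapping.lookup (Poly_Mapping.single 0 a * p) t = a * Poly_Mapping.lookup p t"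
    for a and p :: "('v, 'k) mpoly" and t
    by (simp add: mult_map_scale_conv_mult[symmetric] map.rep_eq when_def)
  have "(\<Sum>\<alpha>\<in>A. Poly_Mapping.single 0 (f \<alpha>) * (\<Prod>i<n. y i ^ \<alpha> i)) = 0"
  proof (rule poly_mapping_eqI)
    fix t
    have "(\<Sum>\<alpha>\<in>A. f \<alpha> * Poly_Mapping.lookup (\<Prod>i<n. y i ^ \<alpha> i) t) = 0"
    proof (cases "t \<in> B")
      case False
      then have "Poly_Mapping.lookup (\<Prod>i<n. y i ^ \<alpha> i) t = 0" if "\<alpha> \<in> A" for \<alpha>
        unfolding not_in_keys_iff_lookup_eq_zero[symmetric] using keys[OF that] by blast
      then show ?thesis by simp
    qed (use f in blast)
    then show "Poly_Mapping.lookup (\<Sum>\<alpha>\<in>A. Poly_Mapping.single 0 (f \<alpha>) * (\<Prod>i<n. y i ^ \<alpha> i)) t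
        = Poly_Mapping.lookup 0 t"
      by (simp add: lookup_sum lookup)
  qed
  also have "(\<Sum>\<alpha>\<in>A. Poly_Mapping.single 0 (f \<alpha>) * (\<Prod>i<n. y i ^ \<alpha> i))
      = (\<Sum>\<alpha>\<in>S. Poly_Mapping.single 0 (f \<alpha>) * (\<Prod>i<n. y i ^ \<alpha> i))"
    unfolding S_def using \<open>finite A\<close> by (intro sum.mono_neutral_right) auto
  finally show thesis
    using f(1) \<open>finite A\<close> by (intro that[of S f]) (auto simp: S_def A_def)
qed

section \<open>Chains of prime ideals in polynomial rings\<close>

text \<open>This is the step that links dependence to chains.  Let \<open>a\<close> be the lowest exponent of \<open>x k\<close>
  in a relation and write the relation as \<open>(x k)^a (F + x k G)\<close>, where \<open>F\<close> does not involve \<open>x k\<close>.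
  If it lies in \<open>P k\<close>, then so does \<open>F + x k G\<close>, because \<open>x k \<notin> P k\<close>; as \<open>x k \<in> P (k + 1)\<close>, it
  follows that \<open>F \<in> P (k + 1)\<close>, and \<open>F\<close> is a relation between the remaining elements.  At the end of
  the chain a nonzero constant would lie in \<open>P n\<close>.  The exponent vectors in \<open>S\<close> have to differ at
  some index from \<open>k\<close> on, since equal monomials could cancel.\<close>

lemma relation_not_in_prime_chain:
  fixes P :: "nat \<Rightarrow> ('v, 'k::field) mpoly set"
  assumes P: "prime_chain (mpoly_ring V) n P"
    and x: "\<And>i. i < n \<Longrightarrow> x i \<in> P (Suc i) - P i"
    and "k \<le> n" and "finite S" "S \<noteq> {}" and c: "\<And>\<alpha>. \<alpha> \<in> S \<Longrightarrow> c \<alpha> \<noteq> 0"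
    and inj: "\<And>\<alpha> \<beta>. \<alpha> \<in> S \<Longrightarrow> \<beta> \<in> S \<Longrightarrow> \<forall>i\<in>{k..<n}. \<alpha> i = \<beta> i \<Longrightarrow> \<alpha> = \<beta>"
  shows "(\<Sum>\<alpha>\<in>S. Poly_Mapping.single 0 (c \<alpha>) * (\<Prod>i=k..<n. x i ^ \<alpha> i)) \<notin> P k"
  using assms(3-)
proof (induction k arbitrary: S rule: inc_induct)
  case base
  interpret primeideal "P n" "mpoly_ring V"
    using P by (simp add: prime_chain_def)
  obtain \<alpha> where \<alpha>: "\<alpha> \<in> S"
    using base(2) by blast
  then have S: "S = {\<alpha>}"
    using base(4) by auto
  show ?case
  proof
    assume "(\<Sum>\<alpha>\<in>S. Poly_Mapping.single 0 (c \<alpha>) * (\<Prod>i=n..<n. x i ^ \<alpha> i)) \<in> P n"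
    then have "Poly_Mapping.single 0 (c \<alpha>) \<in> P n"
      by (simp add: S)
    moreover have "Poly_Mapping.single 0 (inverse (c \<alpha>)) \<in> carrier (mpoly_ring V)"
      by (simp add: mem_mpoly_ring_iff)
    ultimately have "Poly_Mapping.single 0 (inverse (c \<alpha>)) * Poly_Mapping.single 0 (c \<alpha>) \<in> P n"
      using I_l_closed by fastforce
    moreover have "Poly_Mapping.single 0 (inverse (c \<alpha>)) * Poly_Mapping.single 0 (c \<alpha>)
        = (1 :: ('v, 'k) mpoly)"
      using base(3)[OF \<alpha>] by (simp add: mult_single)
    ultimately show False
      using I_notcarr one_imp_carrier by simp
  qed
next
  case (step k)
  interpret k: primeideal "P k" "mpoly_ring V"
    using P step.hyps by (simp add: prime_chain_def)
  interpret k1: primeideal "P (Suc k)" "mpoly_ring V"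
    using P step.hyps by (simp add: prime_chain_def)
  have sub: "P k \<subseteq> P (Suc k)"
    using P step.hyps by (auto simp: prime_chain_def)
  have carr: "x i \<in> carrier (mpoly_ring V)" if "i < n" for i
  proof -
    have "ideal (P (Suc i)) (mpoly_ring V)"
      using P that by (auto simp: prime_chain_def primeideal_def)
    then show ?thesis
      using x[OF that] mpoly_ideal_closed(1) by blast
  qed
  define a where "a = Min ((\<lambda>\<alpha>. \<alpha> k) ` S)"
  have a_le: "a \<le> \<alpha> k" if "\<alpha> \<in> S" for \<alpha>
    using that step.prems unfolding a_def by simp
  define T where "T = {\<alpha>\<in>S. \<alpha> k = a}"
  have "a \<in> (\<lambda>\<alpha>. \<alpha> k) ` S"
    using step.prems unfolding a_def by (intro Min_in) auto
  then have "T \<noteq> {}" by (auto simp: T_def)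
  define mon where "mon \<alpha> = Poly_Mapping.single 0 (c \<alpha>) * (\<Prod>i=Suc k..<n. x i ^ \<alpha> i)" for \<alpha>
  have mon: "mon \<alpha> \<in> carrier (mpoly_ring V)" for \<alpha>
  proof -
    have "(\<Prod>i=Suc k..<n. x i ^ \<alpha> i) \<in> carrier (mpoly_ring V)"
      by (intro mpoly_carrier_sum_prod mpoly_carrier_closed carr) auto
    moreover have "Poly_Mapping.single 0 (c \<alpha>) \<in> carrier (mpoly_ring V)"
      by (simp add: mem_mpoly_ring_iff)
    ultimately show ?thesis
      unfolding mon_def by (intro mpoly_carrier_closed)
  qed
  define F where "F = (\<Sum>\<alpha>\<in>T. mon \<alpha>)"
  define G where "G = (\<Sum>\<alpha>\<in>S - T. mon \<alpha> * x k ^ (\<alpha> k - Suc a))"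
  have F: "F \<in> carrier (mpoly_ring V)"
    unfolding F_def by (intro mpoly_carrier_sum_prod mon)
  have G: "G \<in> carrier (mpoly_ring V)"
    unfolding G_def using step.hyps
    by (intro mpoly_carrier_sum_prod mpoly_carrier_closed mon carr)
  have F_notin: "F \<notin> P (Suc k)"
    unfolding F_def mon_def
  proof (rule step.IH)
    show "finite T" "T \<noteq> {}" "\<And>\<alpha>. \<alpha> \<in> T \<Longrightarrow> c \<alpha> \<noteq> 0"
      using step.prems \<open>T \<noteq> {}\<close> by (auto simp: T_def)
    fix \<alpha> \<beta>
    assume "\<alpha> \<in> T" "\<beta> \<in> T" and eq: "\<forall>i\<in>{Suc k..<n}. \<alpha> i = \<beta> i"
    then have "\<alpha> \<in> S" "\<beta> \<in> S" "\<alpha> k = \<beta> k" by (auto simp: T_def)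
    moreover have "\<alpha> i = \<beta> i" if "i \<in> {k..<n}" for i
      using that eq \<open>\<alpha> k = \<beta> k\<close> by (cases "i = k") auto
    ultimately show "\<alpha> = \<beta>" using step.prems(4) by blast
  qed
  have "(\<Sum>\<alpha>\<in>S. Poly_Mapping.single 0 (c \<alpha>) * (\<Prod>i=k..<n. x i ^ \<alpha> i))
      = (\<Sum>\<alpha>\<in>S. mon \<alpha> * x k ^ \<alpha> k)"
    using step.hyps by (simp add: mon_def prod.atLeast_Suc_lessThan mult_ac)
  also have "\<dots> = (\<Sum>\<alpha>\<in>T. mon \<alpha> * x k ^ \<alpha> k) + (\<Sum>\<alpha>\<in>S - T. mon \<alpha> * x k ^ \<alpha> k)"
    using step.prems by (subst add.commute, intro sum.subset_diff) (auto simp: T_def)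
  also have "(\<Sum>\<alpha>\<in>T. mon \<alpha> * x k ^ \<alpha> k) = x k ^ a * F"
    by (simp add: F_def T_def sum_distrib_left mult.commute)
  also have "(\<Sum>\<alpha>\<in>S - T. mon \<alpha> * x k ^ \<alpha> k) = x k ^ a * (x k * G)"
  proof -
    have "x k ^ \<alpha> k = x k ^ a * (x k * x k ^ (\<alpha> k - Suc a))" if "\<alpha> \<in> S - T" for \<alpha>
    proof -
      have "\<alpha> k = a + Suc (\<alpha> k - Suc a)"
        using a_le[of \<alpha>] that by (auto simp: T_def)
      then show ?thesis by (metis power_Suc power_add)
    qed
    then show ?thesis
      by (simp add: G_def sum_distrib_left mult_ac)
  qed
  also have "x k ^ a * F + x k ^ a * (x k * G) = x k ^ a * (F + x k * G)"
    by (simp add: distrib_left)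
  finally have eq: "(\<Sum>\<alpha>\<in>S. Poly_Mapping.single 0 (c \<alpha>) * (\<Prod>i=k..<n. x i ^ \<alpha> i))
      = x k ^ a * (F + x k * G)" .
  show ?case
  proof
    assume "(\<Sum>\<alpha>\<in>S. Poly_Mapping.single 0 (c \<alpha>) * (\<Prod>i=k..<n. x i ^ \<alpha> i)) \<in> P k"
    then have in_k: "x k ^ a * (F + x k * G) \<in> P k" by (simp add: eq)
    have xk: "x k \<in> carrier (mpoly_ring V)" "x k \<notin> P k" "x k \<in> P (Suc k)"
      using carr x step.hyps by auto
    have xG: "x k * G \<in> P (Suc k)"
      using mpoly_ideal_closed(5)[OF k1.is_ideal xk(3) G] by (simp add: mult.commute)
    have H: "F + x k * G \<in> carrier (mpoly_ring V)"
      using mpoly_carrier_closed(1)[OF F k1.a_Hcarr[OF xG]] .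
    have "F + x k * G \<in> P k" using in_k
    proof (induction a)
      case (Suc a)
      have "x k ^ a * (F + x k * G) \<in> carrier (mpoly_ring V)"
        using mpoly_carrier_closed(2)[OF mpoly_carrier_closed(3)[OF xk(1)] H] .
      then have "x k ^ a * (F + x k * G) \<in> P k"
        using k.I_prime[OF xk(1)] Suc.prems xk(2) by (simp add: mult.assoc)
      then show ?case by (rule Suc.IH)
    qed simp
    then have FG: "F + x k * G \<in> P (Suc k)" using sub by blast
    have "(F + x k * G) - x k * G \<in> P (Suc k)"
      using mpoly_ideal_closed(4)[OF k1.is_ideal FG xG] .
    then show False using F_notin by simp
  qed
qed

lemma coordinate_ideal_subset:
  fixes I :: "('v, 'k::field) mpoly set"
  assumes I: "ideal I (mpoly_ring V)" and var: "\<And>u. u \<in> V - W \<Longrightarrow> variable u \<in> I"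
  shows "coordinate_ideal V W \<subseteq> I"
proof
  fix p :: "('v, 'k) mpoly"
  assume p: "p \<in> coordinate_ideal V W"
  have "Poly_Mapping.single t (Poly_Mapping.lookup p t) \<in> I" if t: "t \<in> Poly_Mapping.keys p" for t
  proof -
    obtain u where u: "u \<in> Poly_Mapping.keys t" "u \<in> V - W"
      using p t unfolding coordinate_ideal_def mem_mpoly_ring_iff by blast
    define s where "s = t - Poly_Mapping.single u 1"
    have st: "s + Poly_Mapping.single u 1 = t"
      using u(1) by (intro poly_mapping_eqI)
        (auto simp: s_def lookup_add lookup_minus lookup_single when_def in_keys_iff)
    have "Poly_Mapping.keys s \<subseteq> Poly_Mapping.keys t"
      using st keys_add_nat[of s "Poly_Mapping.single u 1"] by auto
    also have "Poly_Mapping.keys t \<subseteq> V"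
      using p t by (simp add: coordinate_ideal_def mem_mpoly_ring_iff)
    finally have "Poly_Mapping.single s (Poly_Mapping.lookup p t) \<in> carrier (mpoly_ring V)"
      by (simp add: mem_mpoly_ring_iff)
    then have "Poly_Mapping.single s (Poly_Mapping.lookup p t) * variable u \<in> I"
      using mpoly_ideal_closed(5)[OF I var[OF u(2)]] by simp
    then show ?thesis
      using st by (simp add: variable_def mult_single)
  qed
  then show "p \<in> I"
    using mpoly_ideal_sum[OF I, of "Poly_Mapping.keys p"] mpoly_eq_sum_terms[of p] by metis
qed

text \<open>Since \<open>P 0\<close> contains the coordinate ideal of the set \<open>W\<close> of variables outside \<open>P 0\<close>, the
  elements that witness the strict inclusions can be replaced by their restrictions to \<open>W\<close>.  If
  there were more than \<open>|W|\<close> of them, they would be algebraically dependent, and a relation, having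
  the value \<open>0\<close>, lies in \<open>P 0\<close>.\<close>

lemma prime_chain_length_le:
  fixes P :: "nat \<Rightarrow> ('v, 'k::field) mpoly set"
  assumes P: "prime_chain (mpoly_ring V) n P" and "finite V"
  shows "n \<le> card {u\<in>V. variable u \<notin> P 0}"
proof (rule ccontr)
  define W where "W = {u\<in>V. (variable u :: ('v, 'k) mpoly) \<notin> P 0}"
  assume "\<not> n \<le> card {u\<in>V. variable u \<notin> P 0}"
  then have W: "finite W" "card W < n"
    using \<open>finite V\<close> by (simp_all add: W_def)
  have ideal: "ideal (P i) (mpoly_ring V)" if "i \<le> n" for i
    using P that by (auto simp: prime_chain_def primeideal_def)
  have strict: "P i \<subset> P (Suc i)" if "i < n" for i
    using P that by (auto simp: prime_chain_def)
  have "\<forall>i. \<exists>z. i < n \<longrightarrow> z \<in> P (Suc i) - P i"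
    using strict by blast
  then obtain z where z: "\<And>i. i < n \<Longrightarrow> z i \<in> P (Suc i) - P i"
    by metis
  define y where "y i = restrict_vars W (z i)" for i
  have zero: "P 0 \<subseteq> P i" if "i \<le> n" for i
    using that
  proof (induction i)
    case (Suc i)
    then show ?case using strict[of i] by auto
  qed simp
  have coord: "coordinate_ideal V W \<subseteq> P i" if "i \<le> n" for i
  proof -
    have "coordinate_ideal V W \<subseteq> P 0"
      using ideal[of 0] by (rule coordinate_ideal_subset) (auto simp: W_def)
    then show ?thesis using zero[OF that] by blast
  qed
  have y: "y i \<in> P (Suc i) - P i" if i: "i < n" for i
  proof -
    have id: "ideal (P i) (mpoly_ring V)" "ideal (P (Suc i)) (mpoly_ring V)"
      using ideal i by simp_all
    have "z i \<in> carrier (mpoly_ring V)"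
      using z[OF i] mpoly_ideal_closed(1)[OF id(2)] by blast
    then have "z i - y i \<in> coordinate_ideal V W"
      by (auto simp: coordinate_ideal_def mem_mpoly_ring_iff keys_diff_restrict_vars y_def)
    then have d: "z i - y i \<in> P i" "z i - y i \<in> P (Suc i)"
      using coord i by (meson Suc_leI less_imp_le subsetD)+
    have "z i - (z i - y i) \<in> P (Suc i)"
      using z[OF i] mpoly_ideal_closed(4)[OF id(2) _ d(2)] by blast
    moreover have "y i \<notin> P i"
      using mpoly_ideal_closed(3)[OF id(1) d(1), of "y i"] z[OF i] by auto
    ultimately show ?thesis by simp
  qed
  have y_carr: "y i \<in> carrier (mpoly_ring W)" for i
    unfolding y_def by (rule restrict_vars_mem)
  obtain S c where S: "finite S" "S \<noteq> {}" "S \<subseteq> PiE {..<n} (\<lambda>_. UNIV)"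
    "\<And>\<alpha>. \<alpha> \<in> S \<Longrightarrow> c \<alpha> \<noteq> 0"
    and rel: "(\<Sum>\<alpha>\<in>S. Poly_Mapping.single 0 (c \<alpha>) * (\<Prod>i<n. y i ^ \<alpha> i)) = 0"
    by (rule algebraically_dependent[of W n y, OF W y_carr]) (rule that)
  have "(\<Sum>\<alpha>\<in>S. Poly_Mapping.single 0 (c \<alpha>) * (\<Prod>i=0..<n. y i ^ \<alpha> i)) \<notin> P 0"
  proof (rule relation_not_in_prime_chain[OF P y])
    fix \<alpha> \<beta>
    assume "\<alpha> \<in> S" "\<beta> \<in> S" "\<forall>i\<in>{0..<n}. \<alpha> i = \<beta> i"
    then show "\<alpha> = \<beta>"
      using S(3) by (intro PiE_ext[of \<alpha> "{..<n}" "\<lambda>_. UNIV" \<beta>]) auto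
  qed (use S in auto)
  moreover have "(0 :: ('v, 'k) mpoly) \<in> P 0"
    using mpoly_ideal_closed(2)[OF ideal[of 0]] by simp
  ultimately show False
    using rel by (simp add: atLeast0LessThan)
qed

section \<open>Squarefree monomial ideals\<close>

lemma primeideal_prod_variables:
  fixes P :: "('v, 'k::field) mpoly set"
  assumes P: "primeideal P (mpoly_ring V)" and "finite U" "U \<subseteq> V"
    and "(\<Prod>u\<in>U. variable u) \<in> P"
  shows "\<exists>u\<in>U. variable u \<in> P"
proof -
  interpret primeideal P "mpoly_ring V" by fact
  show ?thesis
    using assms(2-)
  proof (induction U rule: finite_induct)
    case empty
    then show ?case using I_notcarr one_imp_carrier by simp
  next
    case (insert u U)
    then show ?case
      using I_prime[OF variable_in_mpoly_ring prod_variable_in_mpoly_ring, of u U]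
      by auto
  qed
qed

lemma keys_prod_variables:
  assumes "finite U"
  shows "Poly_Mapping.keys (\<Prod>u\<in>U. variable u :: ('v, 'k::field) mpoly)
    = {\<Sum>u\<in>U. Poly_Mapping.single u 1}"
proof -
  have "(\<Prod>u\<in>U. variable u :: ('v, 'k) mpoly) = Poly_Mapping.single (\<Sum>u\<in>U. Poly_Mapping.single u 1) 1"
    using assms by (induction U rule: finite_induct) (auto simp: variable_def mult_single)
  then show ?thesis by simp
qed

lemma keys_sum_single:
  assumes "finite U"
  shows "Poly_Mapping.keys (\<Sum>u\<in>U. Poly_Mapping.single u (1::nat)) = U"
  using assms by (induction U rule: finite_induct) (auto simp: keys_add_nat)

text \<open>The sets that contain no member of \<open>\<U>\<close> are the faces of the Stanley--Reisner complex of the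
  ideal, so this is the formula for the dimension of a Stanley--Reisner ring.  For the upper bound,
  the variables outside the first prime of a chain form such a face.\<close>

theorem krull_dim_squarefree_monomial_quotient:
  fixes V :: "'v::linorder set" and \<U> :: "'v set set"
  defines "I \<equiv> genideal (mpoly_ring V) {\<Prod>u\<in>U. variable u :: ('v, 'k::field) mpoly | U. U \<in> \<U>}"
  assumes "finite V" and \<U>: "\<And>U. U \<in> \<U> \<Longrightarrow> U \<subseteq> V"
    and W: "W \<subseteq> V" "\<And>U. U \<in> \<U> \<Longrightarrow> \<not> U \<subseteq> W"
    and max: "\<And>W'. W' \<subseteq> V \<Longrightarrow> (\<And>U. U \<in> \<U> \<Longrightarrow> \<not> U \<subseteq> W') \<Longrightarrow> card W' \<le> card W"
  shows "krull_dim (mpoly_ring V Quot I) = enat (card W)"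
proof (rule antisym)
  let ?G = "{\<Prod>u\<in>U. variable u :: ('v, 'k::field) mpoly | U. U \<in> \<U>}"
  interpret cring "mpoly_ring V :: ('v, 'k) mpoly ring" by (rule mpoly_ring_cring)
  have fin: "finite U" if "U \<in> \<U>" for U
    using \<U>[OF that] \<open>finite V\<close> finite_subset by blast
  have G: "?G \<subseteq> carrier (mpoly_ring V)"
    using prod_variable_in_mpoly_ring[OF \<U>] by blast
  have I: "ideal I (mpoly_ring V)"
    unfolding I_def by (rule genideal_ideal[OF G])
  have "?G \<subseteq> coordinate_ideal V W"
  proof
    fix p assume p: "p \<in> ?G"
    then obtain U where U: "U \<in> \<U>" "p = (\<Prod>u\<in>U. variable u)" by blast
    then show "p \<in> coordinate_ideal V W"
      using G p W(2)[OF U(1)] fin[OF U(1)]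
      unfolding coordinate_ideal_def U(2) by (auto simp: keys_prod_variables keys_sum_single[simplified])
  qed
  then have "I \<subseteq> coordinate_ideal V W"
    unfolding I_def by (rule genideal_minimal[OF ideal_coordinate_ideal])
  then show "enat (card W) \<le> krull_dim (mpoly_ring V Quot I)"
    using I W(1) \<open>finite V\<close> finite_subset by (intro card_le_krull_dim_quotient) auto
  show "krull_dim (mpoly_ring V Quot I) \<le> enat (card W)"
    unfolding krull_dim_quotient[OF I]
  proof (rule Sup_least)
    fix d assume "d \<in> {enat n | n. \<exists>P. prime_chain (mpoly_ring V) n P \<and> I \<subseteq> P 0}"
    then obtain n P where P: "d = enat n" "prime_chain (mpoly_ring V) n P" "I \<subseteq> P 0" by blast
    let ?W = "{u\<in>V. variable u \<notin> P 0}"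
    have prime: "primeideal (P 0) (mpoly_ring V)"
      using P(2) by (simp add: prime_chain_def)
    have "\<not> U \<subseteq> ?W" if U: "U \<in> \<U>" for U
    proof -
      have "(\<Prod>u\<in>U. variable u) \<in> P 0"
        using U P(3) genideal_self[OF G] unfolding I_def by blast
      then show ?thesis
        using primeideal_prod_variables[OF prime fin[OF U] \<U>[OF U]] by blast
    qed
    then have "card ?W \<le> card W"
      by (intro max) auto
    then show "d \<le> enat (card W)"
      using prime_chain_length_le[OF P(2) \<open>finite V\<close>] P(1) by simp
  qed
qed

section \<open>Matchings of friendship graphs\<close>

definition base_edge :: "nat \<Rightarrow> nat set" where
  "base_edge i = {2 * i + 1, 2 * i + 2}"

lemma base_edge_disjoint: "i \<noteq> j \<Longrightarrow> base_edge i \<inter> base_edge j = {}"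
  unfolding base_edge_def by (auto; presburger)

lemma inj_base_edge: "inj_on base_edge B"
  by (rule inj_onI) (auto simp: base_edge_def doubleton_eq_iff)

lemma matching_base_edges:
  assumes "B \<subseteq> {..<m}"
  shows "matching (friendship_graph m) (card B) (base_edge ` B)"
proof -
  have "finite B" using assms finite_subset by blast
  moreover have "base_edge ` B \<subseteq> edges (friendship_graph m)"
    using assms by (auto simp: friendship_graph_def base_edge_def)
  moreover have "disjoint (base_edge ` B)"
    by (auto simp: disjoint_def) (metis base_edge_disjoint disjoint_iff)+
  ultimately show ?thesis
    by (simp add: matching_def card_image[OF inj_base_edge])
qed

text \<open>The common vertex \<open>0\<close> lies on none of the base edges, so it can be matched with an endpoint
  of a base edge that is not used.\<close>

lemma matching_insert_hub_edge:
  assumes "B \<subseteq> {..<m}" and "j < m" "j \<notin> B" and u: "u \<in> base_edge j"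
  shows "matching (friendship_graph m) (Suc (card B)) (insert {0, u} (base_edge ` B))"
proof -
  have M: "matching (friendship_graph m) (card B) (base_edge ` B)"
    by (rule matching_base_edges) fact
  have "u \<notin> base_edge i" if "i \<in> B" for i
    using base_edge_disjoint[of i j] that assms(3) u by blast
  then have disj: "{0, u} \<inter> e = {}" if "e \<in> base_edge ` B" for e
    using that by (auto simp: base_edge_def)
  then have "{0, u} \<notin> base_edge ` B" by blast
  moreover have "{0, u} \<in> edges (friendship_graph m)"
    using u \<open>j < m\<close> by (auto simp: friendship_graph_def base_edge_def)
  moreover have "disjoint (insert {0, u} (base_edge ` B))"
    using M disj by (auto simp: matching_def disjoint_def)
  ultimately show ?thesis
    using M by (simp add: matching_def)
qed

definition matching_free_set :: "nat \<Rightarrow> nat \<Rightarrow> nat set" where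
  "matching_free_set m q = (\<lambda>i. 2 * i + 1) ` {..<m} \<union> (\<lambda>i. 2 * i + 2) ` {..<q - 1}"

lemma card_matching_free_set:
  assumes "1 \<le> q"
  shows "card (matching_free_set m q) = m + q - 1"
proof -
  have "(\<lambda>i. 2 * i + 1) ` {..<m} \<inter> (\<lambda>i. 2 * i + 2) ` {..<q - 1} = ({} :: nat set)"
    by (auto; presburger)
  then show ?thesis
    using assms unfolding matching_free_set_def
    by (subst card_Un_disjoint) (auto simp: card_image inj_on_def)
qed

lemma not_subset_matching_free_set:
  assumes "1 \<le> q" and M: "matching (friendship_graph m) q M"
  shows "\<not> \<Union>M \<subseteq> matching_free_set m q"
proof
  assume sub: "\<Union>M \<subseteq> matching_free_set m q"
  have "M \<subseteq> base_edge ` {..<q - 1}"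
  proof
    fix e assume e: "e \<in> M"
    then have "e \<subseteq> matching_free_set m q" using sub by blast
    then have "0 \<notin> e" by (auto simp: matching_free_set_def)
    then obtain i where i: "e = base_edge i"
      using e M by (auto simp: matching_def friendship_graph_def base_edge_def)
    then have "2 * i + 2 \<in> matching_free_set m q"
      using \<open>e \<subseteq> matching_free_set m q\<close> by (auto simp: base_edge_def)
    then have "i < q - 1"
      unfolding matching_free_set_def by (auto; presburger)
    then show "e \<in> base_edge ` {..<q - 1}" using i by simp
  qed
  then have "card M \<le> q - 1"
    using surj_card_le[of "{..<q - 1}" M base_edge] by simp
  then show False
    using M assms(1) by (simp add: matching_def)
qed

text \<open>Let \<open>L\<close> and \<open>R\<close> index the base edges whose left, respectively right, endpoint lies in \<open>W\<close>.
  Apart from the common vertex, \<open>W\<close> has \<open>|L| + |R| = |L \<union> R| + |L \<inter> R|\<close> elements, where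
  \<open>|L \<union> R| \<le> m\<close> and \<open>|L \<inter> R| \<le> q - 1\<close> because the base edges indexed by \<open>L \<inter> R\<close> form a matching
  inside \<open>W\<close>.  If \<open>W\<close> contains the common vertex, the two bounds cannot both be attained: an edge of
  \<open>L \<union> R\<close> outside \<open>L \<inter> R\<close> would provide a partner for that vertex and complete a
  \<open>q\<close>-matching.\<close>

lemma card_le_if_no_matching_inside:
  assumes "1 \<le> q" "q \<le> m" and W: "W \<subseteq> {0..2 * m}"
    and none: "\<And>M. matching (friendship_graph m) q M \<Longrightarrow> \<not> \<Union>M \<subseteq> W"
  shows "card W \<le> m + q - 1"
proof -
  define L where "L = {i. i < m \<and> 2 * i + 1 \<in> W}"
  define R where "R = {i. i < m \<and> 2 * i + 2 \<in> W}"
  have fin: "finite L" "finite R" "finite W"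
    using W finite_subset by (auto simp: L_def R_def)
  have "card (L \<union> R) \<le> card {..<m}"
    by (rule card_mono) (auto simp: L_def R_def)
  then have LR: "card (L \<union> R) \<le> m" by simp
  have "W - {0} \<subseteq> (\<lambda>i. 2 * i + 1) ` L \<union> (\<lambda>i. 2 * i + 2) ` R"
  proof
    fix u assume u: "u \<in> W - {0}"
    define i where "i = (u - 1) div 2"
    have "u = 2 * i + 1 \<or> u = 2 * i + 2" "i < m"
      using u W unfolding i_def by (auto; presburger)+
    then show "u \<in> (\<lambda>i. 2 * i + 1) ` L \<union> (\<lambda>i. 2 * i + 2) ` R"
      using u by (auto simp: L_def R_def)
  qed
  then have "card (W - {0}) \<le> card ((\<lambda>i. 2 * i + 1) ` L \<union> (\<lambda>i. 2 * i + 2) ` R)"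
    using fin by (intro card_mono) auto
  also have "\<dots> \<le> card L + card R"
    using card_Un_le card_image_le fin by (meson add_mono order_trans)
  also have "\<dots> = card (L \<union> R) + card (L \<inter> R)"
    by (rule card_Un_Int) (use fin in auto)
  finally have W0: "card (W - {0}) \<le> card (L \<union> R) + card (L \<inter> R)" .
  have LR_sub: "L \<inter> R \<subseteq> {..<m}" by (auto simp: L_def)
  have inside: "\<Union> (base_edge ` B) \<subseteq> W" if "B \<subseteq> L \<inter> R" for B
    using that by (auto simp: base_edge_def L_def R_def)
  have few: "card (L \<inter> R) \<le> q - 1"
  proof (rule ccontr)
    assume "\<not> card (L \<inter> R) \<le> q - 1"
    then have "q \<le> card (L \<inter> R)" by simp
    then obtain B where B: "B \<subseteq> L \<inter> R" "card B = q"
      using obtain_subset_with_card_n by metis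
    then show False
      using none matching_base_edges[OF order_trans[OF B(1) LR_sub]] inside[OF B(1)] by blast
  qed
  show ?thesis
  proof (cases "0 \<in> W")
    case False
    then show ?thesis using W0 LR few assms(1) by simp
  next
    case True
    have "card W = Suc (card (W - {0}))"
      using card.remove[OF fin(3) True] .
    moreover have "card (L \<union> R) + card (L \<inter> R) < m + q - 1"
    proof (rule ccontr)
      assume "\<not> card (L \<union> R) + card (L \<inter> R) < m + q - 1"
      then have eq: "card (L \<inter> R) = q - 1" "card (L \<union> R) = m"
        using LR few assms(1) by auto
      then have "L \<union> R \<noteq> L \<inter> R" using assms by auto
      then obtain j where j: "j \<in> L \<union> R" "j \<notin> L \<inter> R" by blast
      then obtain u where u: "u \<in> base_edge j" "u \<in> W" "j < m"
        by (auto simp: L_def R_def base_edge_def)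
      have "matching (friendship_graph m) q (insert {0, u} (base_edge ` (L \<inter> R)))"
        using matching_insert_hub_edge[OF LR_sub u(3) j(2) u(1)] eq(1) assms(1) by simp
      then show False
        using none inside[of "L \<inter> R"] u(2) True by auto
    qed
    ultimately show ?thesis using W0 by simp
  qed
qed

theorem theorem7p18:
  fixes m q :: nat
  assumes "m \<ge> 1" and "1 \<le> q" and "q \<le> m"
  shows "krull_dim
      ((mpoly_ring (verts (friendship_graph m)) :: (nat, 'k::field) mpoly ring)
        Quot squarefree_power (friendship_graph m) q)
    = enat (m + q - 1)"
proof -
  let ?X = "friendship_graph m"
  let ?\<U> = "{\<Union>M | M. matching ?X q M}"
  have gens: "{\<Prod>u\<in>\<Union>M. variable u :: (nat, 'k) mpoly | M. matching ?X q M}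
      = {\<Prod>u\<in>U. variable u | U. U \<in> ?\<U>}"
    by blast
  have V: "verts ?X = {0..2 * m}" by (simp add: friendship_graph_def)
  have "krull_dim ((mpoly_ring (verts ?X) :: (nat, 'k) mpoly ring) Quot squarefree_power ?X q)
      = enat (card (matching_free_set m q))"
    unfolding squarefree_power_def gens
  proof (rule krull_dim_squarefree_monomial_quotient)
    show "finite (verts ?X)" by (simp add: V)
    show "matching_free_set m q \<subseteq> verts ?X"
      using \<open>q \<le> m\<close> by (auto simp: V matching_free_set_def)
    fix U assume U: "U \<in> ?\<U>"
    then show "U \<subseteq> verts ?X"
      using simple_graph_friendship_graph[of m] unfolding simple_graph_def matching_def by blast
    show "\<not> U \<subseteq> matching_free_set m q"
      using U not_subset_matching_free_set[OF \<open>1 \<le> q\<close>] by auto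
  next
    fix W
    assume "W \<subseteq> verts ?X" and free: "\<And>U. U \<in> ?\<U> \<Longrightarrow> \<not> U \<subseteq> W"
    then have "W \<subseteq> {0..2 * m}" by (simp add: V)
    moreover have "\<not> \<Union>M \<subseteq> W" if "matching ?X q M" for M
      using free[of "\<Union>M"] that by blast
    ultimately show "card W \<le> card (matching_free_set m q)"
      unfolding card_matching_free_set[OF assms(2)]
      by (rule card_le_if_no_matching_inside[OF assms(2,3)])
  qed
  then show ?thesis by (simp add: card_matching_free_set[OF \<open>1 \<le> q\<close>])
qed

end
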